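(* The internal Hilbert series of $X_n$ is binomial: for every integer $j\ge0$, $$h_{n,-}(j)=\begin{cases}\binom{n-1}{j}, & 0\le j<n,\\ 0, & \text{otherwise.}\end{cases}$$
   Context: Let $(e_i)_{i=1}^n$ be the standard basis of $\mathbb{R}^n$, $e_0:=0$, $x_{2i-1}=e_i-e_{i-1}$, $x_{2i}=e_i$ ($i=1,\dots,n$), and $X_n=(x_1\prec\dots\prec x_{2n})$ ordered by index (the edges of the broken wheel graph $BW_n$; $x_1,x_2$ are distinct elements). A basis is an $n$-element subset $B\subseteq X_n$ forming a basis of $\mathbb{R}^n$. $\mathrm{val}(B)=|\{x\in X_n\setminus B:\{x\}\cup\{b\in B:b\prec x\}\text{ linearly independent}\}|$ and $\mathrm{val}^*(B)=|\{b\in B:(B\setminus\{b\})\cup\{x\in X_n\setminus B:b\prec x\}\text{ spans }\mathbb{R}^n\}|$. $B$ is internal if $\mathrm{val}^*(B)=n$, and $h_{n,-}(j)=|\{B \text{ internal}: \mathrm{val}(B)=j\}|$. *)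

theory Defs
  imports "Jordan_Normal_Form.VS_Connect"
begin

text \<open>
  The list X = (x(1), ..., x(2n)) in real n-space is represented by its index set
  \<open>{1..2 * n}\<close>, ordered as natural numbers, together with the vectors \<open>bw_vec n k\<close>.
  Working with indices keeps x(1) and x(2) apart although both are the vector e(1).
\<close>

abbreviation real_space :: "nat \<Rightarrow> (real, real vec) module" where
  "real_space n \<equiv> module_vec TYPE(real) n"

text \<open>
  \<open>std_e n i\<close> is the i-th standard basis vector for \<open>1 \<le> i \<le> n\<close>, and zero for \<open>i = 0\<close>
  (\<open>unit_vec\<close> counts coordinates from 0).
\<close>

definition std_e :: "nat \<Rightarrow> nat \<Rightarrow> real vec" where
  "std_e n i = (if i = 0 then 0\<^sub>v n else unit_vec n (i - 1))"

text \<open>For odd \<open>k = 2 * i - 1\<close> one has \<open>(k + 1) div 2 = i\<close> and \<open>(k - 1) div 2 = i - 1\<close>.\<close>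

definition bw_vec :: "nat \<Rightarrow> nat \<Rightarrow> real vec" where
  "bw_vec n k =
     (if odd k then std_e n ((k + 1) div 2) - std_e n ((k - 1) div 2)
      else std_e n (k div 2))"

definition bw_ground :: "nat \<Rightarrow> nat set" where
  "bw_ground n = {1..2 * n}"

text \<open>
  Independence and bases are those of families: a set of indices that repeats a vector is
  dependent, hence the injectivity conditions.
\<close>

definition bw_indep :: "nat \<Rightarrow> nat set \<Rightarrow> bool" where
  "bw_indep n S \<longleftrightarrow>
     inj_on (bw_vec n) S \<and> \<not> module.lin_dep class_ring (real_space n) (bw_vec n ` S)"

definition bw_spans :: "nat \<Rightarrow> nat set \<Rightarrow> bool" where
  "bw_spans n S \<longleftrightarrow>
     LinearCombinations.module.span class_ring (real_space n) (bw_vec n ` S) = carrier_vec n"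

definition bw_basis :: "nat \<Rightarrow> nat set \<Rightarrow> bool" where
  "bw_basis n B \<longleftrightarrow>
     B \<subseteq> bw_ground n \<and> card B = n \<and> inj_on (bw_vec n) B \<and>
     vectorspace.basis class_ring (real_space n) (bw_vec n ` B)"

definition bw_val :: "nat \<Rightarrow> nat set \<Rightarrow> nat" where
  "bw_val n B = card {x \<in> bw_ground n - B. bw_indep n ({x} \<union> {b \<in> B. b < x})}"

definition bw_val_dual :: "nat \<Rightarrow> nat set \<Rightarrow> nat" where
  "bw_val_dual n B =
     card {b \<in> B. bw_spans n ((B - {b}) \<union> {x \<in> bw_ground n - B. b < x})}"

definition bw_internal :: "nat \<Rightarrow> nat set \<Rightarrow> bool" where
  "bw_internal n B \<longleftrightarrow> bw_basis n B \<and> bw_val_dual n B = n"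

definition bw_hilbert_int :: "nat \<Rightarrow> nat \<Rightarrow> nat" where
  "bw_hilbert_int n j = card {B. bw_internal n B \<and> bw_val n B = j}"

end

theory Submission
  imports Defs
begin

text \<open>
  The internal bases are exactly the transversals of the pairs \<open>{2 i - 1, 2 i}\<close> that avoid
  \<open>2 n\<close>. A transversal spans by triangularity. Conversely, if a basis contained both \<open>2 i - 1\<close>
  and \<open>2 i\<close>, the condition on \<open>b = 2 i - 1\<close> would force at least \<open>i - 1\<close> elements of the
  basis below \<open>b\<close>; then fewer than \<open>n - i\<close> elements lie above \<open>2 i\<close>, too few to span together
  with the first \<open>i\<close> unit vectors. For a transversal, an index \<open>2 i\<close> outside \<open>B\<close> depends on
  smaller elements of \<open>B\<close> and an index \<open>2 i - 1\<close> outside \<open>B\<close> does not, so the valuation is the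
  number of even indices, an arbitrary subset of \<open>n - 1\<close> possibilities.
\<close>

section \<open>Edge vectors and linear spans in real n-space\<close>

abbreviation real_span :: "nat \<Rightarrow> real vec set \<Rightarrow> real vec set" where
  "real_span n A \<equiv> LinearCombinations.module.span class_ring (real_space n) A"

lemma std_e_carrier [simp]: "std_e n i \<in> carrier_vec n"
  by (simp add: std_e_def)

lemma bw_vec_carrier [simp]: "bw_vec n k \<in> carrier_vec n"
  by (simp add: bw_vec_def)

lemma bw_vec_image_carrier [simp]: "bw_vec n ` S \<subseteq> carrier_vec n"
  by auto

lemma bw_vec_even: "bw_vec n (2 * i) = std_e n i"
  by (simp add: bw_vec_def)

lemma bw_vec_odd:
  assumes "i \<ge> 1"
  shows "bw_vec n (2 * i - 1) = std_e n i - std_e n (i - 1)"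
proof -
  have "odd (2 * i - 1)" "(2 * i - 1 + 1) div 2 = i" "(2 * i - 1 - 1) div 2 = i - 1"
    using assms by presburger+
  then show ?thesis by (simp add: bw_vec_def)
qed

lemma real_span_mono: "A \<subseteq> B \<Longrightarrow> real_span n A \<subseteq> real_span n B"
proof -
  interpret vec_space "TYPE(real)" n .
  show "A \<subseteq> B \<Longrightarrow> real_span n A \<subseteq> real_span n B" by (rule span_is_monotone)
qed

lemma real_span_mem: "A \<subseteq> carrier_vec n \<Longrightarrow> v \<in> A \<Longrightarrow> v \<in> real_span n A"
proof -
  interpret vec_space "TYPE(real)" n .
  show "A \<subseteq> carrier_vec n \<Longrightarrow> v \<in> A \<Longrightarrow> v \<in> real_span n A" by (rule span_mem) auto
qed

lemma real_span_zero: "0\<^sub>v n \<in> real_span n A"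
proof -
  interpret vec_space "TYPE(real)" n .
  show ?thesis using span_zero by simp
qed

lemma real_span_closed: "A \<subseteq> carrier_vec n \<Longrightarrow> real_span n A \<subseteq> carrier_vec n"
proof -
  interpret vec_space "TYPE(real)" n .
  show "A \<subseteq> carrier_vec n \<Longrightarrow> real_span n A \<subseteq> carrier_vec n" using span_closed by auto
qed

lemma real_span_add:
  assumes "A \<subseteq> carrier_vec n" "v \<in> real_span n A" "w \<in> real_span n A"
  shows "v + w \<in> real_span n A"
proof -
  interpret vec_space "TYPE(real)" n .
  show ?thesis using span_add1[of A v w] assms by simp
qed

lemma real_span_diff:
  assumes "A \<subseteq> carrier_vec n" "v \<in> real_span n A" "w \<in> real_span n A"
  shows "v - w \<in> real_span n A"
proof -
  interpret vec_space "TYPE(real)" n .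
  have c: "v \<in> carrier_vec n" "w \<in> carrier_vec n"
    using real_span_closed[OF assms(1)] assms by auto
  have "- w \<in> real_span n A"
    using span_neg[of A w] assms c by simp
  then have "v + - w \<in> real_span n A" using assms real_span_add by blast
  then show ?thesis using c by (simp add: minus_add_uminus_vec)
qed

lemma real_span_least:
  assumes "B \<subseteq> carrier_vec n" "A \<subseteq> real_span n B"
  shows "real_span n A \<subseteq> real_span n B"
proof -
  interpret vec_space "TYPE(real)" n .
  show ?thesis using span_subsetI[of B A] assms by simp
qed

lemma real_span_full:
  assumes "A \<subseteq> carrier_vec n" "\<And>k. 1 \<le> k \<Longrightarrow> k \<le> n \<Longrightarrow> std_e n k \<in> real_span n A"
  shows "real_span n A = carrier_vec n"
proof -
  interpret vec_space "TYPE(real)" n .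
  have "set (unit_vecs n) \<subseteq> real_span n A"
  proof
    fix v :: "real vec" assume "v \<in> set (unit_vecs n)"
    then obtain i where "i < n" "v = unit_vec n i" by (auto simp: unit_vecs_def)
    \<comment> \<open>\<open>unit_vec\<close> counts coordinates from 0, so
      \<open>unit_vec n i\<close> is \<open>std_e n (Suc i)\<close>.\<close>
    then show "v \<in> real_span n A" using assms(2)[of "Suc i"] by (simp add: std_e_def)
  qed
  then have "carrier_vec n \<subseteq> real_span n A"
    using real_span_least[OF assms(1)] span_unit_vecs_is_carrier by metis
  then show ?thesis using real_span_closed[OF assms(1)] by blast
qed

lemma real_span_card:
  assumes "finite A" "A \<subseteq> carrier_vec n" "real_span n A = carrier_vec n"
  shows "n \<le> card A"
proof -
  interpret vec_space "TYPE(real)" n .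
  show ?thesis using gen_ge_dim[of A] assms dim_is_n fin_dim by simp
qed

section \<open>Spanning, bases and independence for index sets\<close>

lemma bw_spansI:
  assumes "\<And>k. 1 \<le> k \<Longrightarrow> k \<le> n \<Longrightarrow> std_e n k \<in> real_span n (bw_vec n ` S)"
  shows "bw_spans n S"
  unfolding bw_spans_def by (rule real_span_full) (use assms in auto)

lemma bw_basis_imp_spans: "bw_basis n B \<Longrightarrow> bw_spans n B"
proof -
  interpret vec_space "TYPE(real)" n .
  show "bw_basis n B \<Longrightarrow> bw_spans n B" by (simp add: bw_basis_def bw_spans_def basis_def)
qed

text \<open>A spanning image needs at least n distinct vectors, so n indices cannot repeat a vector;
  and n generators of an n-dimensional space form a basis.\<close>

lemma bw_spans_imp_basis:
  assumes "S \<subseteq> bw_ground n" "card S = n" "bw_spans n S"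
  shows "bw_basis n S"
proof -
  interpret vec_space "TYPE(real)" n .
  have fin: "finite S" using assms(1) by (rule finite_subset) (simp add: bw_ground_def)
  have "n \<le> card (bw_vec n ` S)"
    using real_span_card[of "bw_vec n ` S" n] fin assms(3) by (simp add: bw_spans_def)
  then have card: "card (bw_vec n ` S) = card S"
    using card_image_le[OF fin, of "bw_vec n"] assms(2) by simp
  then have "inj_on (bw_vec n) S" by (rule eq_card_imp_inj_on[OF fin])
  moreover have "basis (bw_vec n ` S)"
    using dim_gen_is_basis[of "bw_vec n ` S"] fin card assms dim_is_n by (simp add: bw_spans_def)
  ultimately show ?thesis using assms by (simp add: bw_basis_def)
qed

lemma bw_basis_indep_subset:
  assumes "bw_basis n B" "S \<subseteq> B"
  shows "bw_indep n S"
proof -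
  interpret vec_space "TYPE(real)" n .
  have "\<not> lin_dep (bw_vec n ` B)" "inj_on (bw_vec n) B"
    using assms(1) by (auto simp: bw_basis_def basis_def)
  then show ?thesis
    using subset_li_is_li[of "bw_vec n ` B" "bw_vec n ` S"] assms(2)
    by (auto simp: bw_indep_def intro: inj_on_subset)
qed

text \<open>Either the new vector repeats one from \<open>S\<close> and injectivity fails, or it is
  a new vector in the span, which is a linear dependence. The first case does occur: indices 1 and 2
  both give e_1.\<close>

lemma bw_not_indep_insert:
  assumes "finite S" "x \<notin> S" "bw_vec n x \<in> real_span n (bw_vec n ` S)"
  shows "\<not> bw_indep n (insert x S)"
proof
  interpret vec_space "TYPE(real)" n .
  assume ind: "bw_indep n (insert x S)"
  then have inj: "inj_on (bw_vec n) (insert x S)"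
    and li: "\<not> lin_dep (bw_vec n ` insert x S)"
    by (auto simp: bw_indep_def)
  have nin: "bw_vec n x \<notin> bw_vec n ` S" using inj assms(2) by auto
  have "\<not> lin_dep (bw_vec n ` S)"
    using subset_li_is_li[OF li] by blast
  then show False
    using lin_dep_iff_in_span[of "bw_vec n ` S" "bw_vec n x"] nin li assms(3) by simp
qed

text \<open>Induction on k starting from e_0 = 0: the even index of a pair gives e_k itself, the odd
  one gives e_k - e_(k-1), to which the previous vector is added. The bound m allows a use on an
  initial segment of pairs only.\<close>

lemma std_e_in_span_of_pairs:
  assumes "\<And>i. 1 \<le> i \<Longrightarrow> i \<le> m \<Longrightarrow> 2 * i - 1 \<in> S \<or> 2 * i \<in> S" "k \<le> m"
  shows "std_e n k \<in> real_span n (bw_vec n ` S)"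
  using assms(2)
proof (induction k)
  case 0
  then show ?case by (simp add: std_e_def real_span_zero)
next
  case (Suc k)
  have mem: "bw_vec n s \<in> real_span n (bw_vec n ` S)" if "s \<in> S" for s
    using that by (intro real_span_mem) auto
  from assms(1)[of "Suc k"] Suc.prems have "2 * Suc k - 1 \<in> S \<or> 2 * Suc k \<in> S" by simp
  then show ?case
  proof
    assume "2 * Suc k \<in> S"
    then show ?thesis using mem bw_vec_even by metis
  next
    assume "2 * Suc k - 1 \<in> S"
    then have "std_e n (Suc k) - std_e n k \<in> real_span n (bw_vec n ` S)"
      using mem bw_vec_odd[of "Suc k" n] by fastforce
    then have "std_e n (Suc k) - std_e n k + std_e n k \<in> real_span n (bw_vec n ` S)"
      using Suc by (intro real_span_add) auto
    moreover have "std_e n (Suc k) - std_e n k + std_e n k = std_e n (Suc k)"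
      using std_e_carrier[of n "Suc k"] std_e_carrier[of n k]
      by (intro eq_vecI) (auto simp del: std_e_carrier)
    ultimately show ?thesis by simp
  qed
qed

section \<open>Transversals of the pairs, encoded by the set of pairs in which the even index is
  chosen\<close>

definition bw_transversal :: "nat \<Rightarrow> nat set \<Rightarrow> nat set" where
  "bw_transversal n E = (\<lambda>i. if i \<in> E then 2 * i else 2 * i - 1) ` {1..n}"

lemma bw_transversal_subset: "bw_transversal n E \<subseteq> bw_ground n"
  by (auto simp: bw_transversal_def bw_ground_def)

lemma card_bw_transversal: "card (bw_transversal n E) = n"
proof -
  have "inj_on (\<lambda>i. if i \<in> E then 2 * i else 2 * i - 1) {1..n}"
    \<comment> \<open>The inverse sends both \<open>2 * i - 1\<close> and \<open>2 * i\<close> back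
      to the pair number i.\<close>
    by (rule inj_on_inverseI[where g = "\<lambda>k. (k + 1) div 2"]) auto
  from card_image[OF this] show ?thesis by (simp only: bw_transversal_def card_atLeastAtMost diff_Suc_1 Suc_eq_plus1[symmetric])
qed

lemma finite_bw_transversal [simp]: "finite (bw_transversal n E)"
  by (simp add: bw_transversal_def)

lemma even_in_bw_transversal:
  assumes "1 \<le> i" "i \<le> n"
  shows "2 * i \<in> bw_transversal n E \<longleftrightarrow> i \<in> E"
proof
  assume "2 * i \<in> bw_transversal n E"
  then obtain k where "1 \<le> k" "2 * i = (if k \<in> E then 2 * k else 2 * k - 1)"
    by (auto simp: bw_transversal_def)
  then show "i \<in> E" by (auto split: if_splits, presburger)
qed (use assms in \<open>force simp: bw_transversal_def\<close>)

lemma odd_in_bw_transversal: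
  assumes "1 \<le> i" "i \<le> n"
  shows "2 * i - 1 \<in> bw_transversal n E \<longleftrightarrow> i \<notin> E"
proof
  assume "2 * i - 1 \<in> bw_transversal n E"
  then obtain k where k: "1 \<le> k" "2 * i - 1 = (if k \<in> E then 2 * k else 2 * k - 1)"
    by (auto simp: bw_transversal_def)
  have "2 * i - 1 \<noteq> 2 * k" using assms by presburger
  with k have "k \<notin> E" "2 * i - 1 = 2 * k - 1" by (auto split: if_splits)
  moreover have "k = i" using calculation(2) k(1) assms by simp
  ultimately show "i \<notin> E" by simp
qed (use assms in \<open>force simp: bw_transversal_def\<close>)

lemma bw_ground_cases:
  assumes "x \<in> bw_ground n"
  obtains i where "1 \<le> i" "i \<le> n" "x = 2 * i" | i where "1 \<le> i" "i \<le> n" "x = 2 * i - 1"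
proof (cases "even x")
  case True
  then obtain i where "x = 2 * i" by blast
  with assms show ?thesis by (intro that(1)[of i]) (auto simp: bw_ground_def)
next
  case False
  then obtain i where "x = 2 * i + 1" by (rule oddE)
  with assms show ?thesis by (intro that(2)[of "Suc i"]) (auto simp: bw_ground_def)
qed

lemma bw_basis_transversal: "bw_basis n (bw_transversal n E)"
proof (rule bw_spans_imp_basis[OF bw_transversal_subset card_bw_transversal], rule bw_spansI)
  fix k assume "1 \<le> k" "k \<le> n"
  then show "std_e n k \<in> real_span n (bw_vec n ` bw_transversal n E)"
    by (intro std_e_in_span_of_pairs[of n])
      (use even_in_bw_transversal odd_in_bw_transversal in blast)+
qed

text \<open>A removed odd index is replaced by its even partner, which is later and outside the
  transversal. A removed even index \<open>2 * i\<close> has no later partner in its pair, but i < n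
  makes the pair i + 1 available to recover e_i.\<close>

lemma bw_internal_transversal:
  assumes "E \<subseteq> {1..<n}"
  shows "bw_internal n (bw_transversal n E)"
proof -
  let ?B = "bw_transversal n E"
  have "bw_spans n ((?B - {b}) \<union> {x \<in> bw_ground n - ?B. b < x})" (is "bw_spans n ?T")
    if b: "b \<in> ?B" for b
  proof (rule bw_spansI)
    fix k assume k: "1 \<le> k" "k \<le> n"
    have "b \<in> bw_ground n" using b bw_transversal_subset by blast
    then show "std_e n k \<in> real_span n (bw_vec n ` ?T)"
    proof (cases rule: bw_ground_cases)
      case (2 i)
      then have "i \<notin> E" using b odd_in_bw_transversal by simp
      then have "2 * i \<in> ?T" using 2 even_in_bw_transversal[of i n E] by (simp add: bw_ground_def)
      moreover have "2 * l - 1 \<in> ?T \<or> 2 * l \<in> ?T" if "1 \<le> l" "l \<le> n" "l \<noteq> i" for l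
      proof -
        have "2 * l - 1 \<noteq> b" "2 * l \<noteq> b" using that 2 by presburger+
        then show ?thesis
          using even_in_bw_transversal[of l n E] odd_in_bw_transversal[of l n E] that by blast
      qed
      ultimately show ?thesis using k by (intro std_e_in_span_of_pairs[of n]) auto
    next
      case (1 i)
      then have "i \<in> E" using b even_in_bw_transversal by simp
      then have i: "1 \<le> i" "i < n" using assms by auto
      have mem: "bw_vec n s \<in> real_span n (bw_vec n ` ?T)" if "s \<in> ?T" for s
        using that by (intro real_span_mem) auto
      \<comment> \<open>Every index after \<open>b\<close> is available, either as a remaining basis
        element or as a later element outside the basis.\<close>
      have above: "s \<in> ?T" if "b < s" "s \<in> bw_ground n" for s using that by auto
      have hi: "std_e n l \<in> real_span n (bw_vec n ` ?T)" if "i < l" "l \<le> n" for l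
        using mem[OF above, of "2 * l"] that 1 by (simp add: bw_vec_even bw_ground_def)
      \<comment> \<open>Below i the untouched lower pairs suffice, and above i the vector e_k is
        itself a later index; only \<open>k = i\<close> uses the relation between neighbouring
        pairs.\<close>
      consider "k < i" | "k = i" | "k > i" by linarith
      then show ?thesis
      proof cases
        case a: 1
        have "2 * l - 1 \<in> ?T \<or> 2 * l \<in> ?T" if "1 \<le> l" "l \<le> k" for l
        proof -
          have "2 * l - 1 \<noteq> b" "2 * l \<noteq> b" "l \<le> n" using that 1 a by presburger+
          then show ?thesis
            using even_in_bw_transversal[of l n E] odd_in_bw_transversal[of l n E] that by blast
        qed
        then show ?thesis by (intro std_e_in_span_of_pairs[of k]) auto
      next
        case 2
        \<comment> \<open>Index \<open>2 * i + 1\<close> carries e_(i+1) - e_i, so subtracting it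
          from e_(i+1) leaves e_i; it exists in the ground set because i < n.\<close>
        have "std_e n (Suc i) - bw_vec n (2 * Suc i - 1) \<in> real_span n (bw_vec n ` ?T)"
          by (intro real_span_diff hi mem above) (use 1 i in \<open>auto simp: bw_ground_def\<close>)
        moreover have "std_e n (Suc i) - bw_vec n (2 * Suc i - 1) = std_e n i"
          using std_e_carrier[of n "Suc i"] std_e_carrier[of n i] bw_vec_odd[of "Suc i" n]
          by (intro eq_vecI) (auto simp del: std_e_carrier)
        ultimately show ?thesis using 2 by simp
      next
        case 3
        then show ?thesis using hi k by simp
      qed
    qed
  qed
  then have "{b \<in> ?B. bw_spans n ((?B - {b}) \<union> {x \<in> bw_ground n - ?B. b < x})} = ?B"
    by blast
  then have "bw_val_dual n ?B = n" by (simp add: bw_val_dual_def card_bw_transversal)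
  then show ?thesis by (simp add: bw_internal_def bw_basis_transversal)
qed

lemma bw_val_transversal:
  assumes "E \<subseteq> {1..n}"
  shows "bw_val n (bw_transversal n E) = card E"
proof -
  let ?B = "bw_transversal n E"
  have "x \<in> {x \<in> bw_ground n - ?B. bw_indep n ({x} \<union> {b \<in> ?B. b < x})} \<longleftrightarrow>
      x \<in> (\<lambda>i. 2 * i - 1) ` E" (is "x \<in> ?L \<longleftrightarrow> _") for x
  proof
    assume x: "x \<in> ?L"
    then have "x \<in> bw_ground n" by blast
    then show "x \<in> (\<lambda>i. 2 * i - 1) ` E"
    proof (cases rule: bw_ground_cases)
      case (1 i)
      \<comment> \<open>Each pair up to i has a member of \<open>?B\<close> strictly below
        \<open>x\<close>; for pair i itself it must be \<open>2 * i - 1\<close>, since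
        \<open>x = 2 * i\<close> lies outside \<open>?B\<close>.\<close>
      have "std_e n i \<in> real_span n (bw_vec n ` {b \<in> ?B. b < x})"
      proof (rule std_e_in_span_of_pairs[of i])
        fix l assume l: "1 \<le> l" "l \<le> i"
        have "2 * l \<in> ?B \<or> 2 * l - 1 \<in> ?B"
          using even_in_bw_transversal[of l n E] odd_in_bw_transversal[of l n E] 1 l by auto
        moreover have "2 * l < x \<or> l = i" "2 * l - 1 < x" using l 1 by auto
        moreover have "2 * i \<notin> ?B" using x 1 by simp
        ultimately show "2 * l - 1 \<in> {b \<in> ?B. b < x} \<or> 2 * l \<in> {b \<in> ?B. b < x}" by auto
      qed simp
      then have "\<not> bw_indep n (insert x {b \<in> ?B. b < x})"
        using 1 by (intro bw_not_indep_insert) (auto simp: bw_vec_even)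
      then show ?thesis using x by simp
    next
      case (2 i)
      then have "i \<in> E" using x odd_in_bw_transversal[of i n E] by simp
      then show ?thesis using 2 by blast
    qed
  next
    assume "x \<in> (\<lambda>i. 2 * i - 1) ` E"
    then obtain i where i: "i \<in> E" "x = 2 * i - 1" "1 \<le> i" "i \<le> n" using assms by auto
    have "x \<in> bw_ground n - ?B"
      using i odd_in_bw_transversal[of i n E] by (auto simp: bw_ground_def)
    \<comment> \<open>Moving pair i to its odd index gives another transversal. It loses only
      \<open>2 * i\<close>, which exceeds \<open>x\<close>, so it is a basis containing
      \<open>x\<close> and all smaller elements of \<open>?B\<close>.\<close>
    moreover have "{x} \<union> {b \<in> ?B. b < x} \<subseteq> bw_transversal n (E - {i})"
    proof
      fix y assume y: "y \<in> {x} \<union> {b \<in> ?B. b < x}"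
      show "y \<in> bw_transversal n (E - {i})"
      proof (cases "y = x")
        case True
        then show ?thesis using i odd_in_bw_transversal[of i n "E - {i}"] by simp
      next
        case False
        then have yB: "y \<in> ?B" "y < x" using y by auto
        then have "y \<in> bw_ground n" using bw_transversal_subset by blast
        then show ?thesis
        proof (cases rule: bw_ground_cases)
          case (1 k)
          then have "k \<noteq> i" using yB(2) i(2) by auto
          then show ?thesis using 1 yB(1) by (simp add: even_in_bw_transversal)
        next
          case (2 k)
          then have "k \<notin> E" using yB(1) odd_in_bw_transversal by blast
          then show ?thesis using 2 odd_in_bw_transversal[of k n "E - {i}"] by simp
        qed
      qed
    qed
    then have "bw_indep n ({x} \<union> {b \<in> ?B. b < x})"
      by (rule bw_basis_indep_subset[OF bw_basis_transversal])
    ultimately show "x \<in> ?L" by blast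
  qed
  then have "{x \<in> bw_ground n - ?B. bw_indep n ({x} \<union> {b \<in> ?B. b < x})} = (\<lambda>i. 2 * i - 1) ` E"
    by blast
  moreover have "inj_on (\<lambda>i::nat. 2 * i - 1) E"
  proof (rule inj_onI)
    fix i l :: nat assume "i \<in> E" "l \<in> E" "2 * i - 1 = 2 * l - 1"
    moreover from this have "i \<ge> 1" "l \<ge> 1" using assms by auto
    ultimately show "i = l" by simp
  qed
  ultimately show ?thesis by (simp add: bw_val_def card_image)
qed

section \<open>Internal bases are transversals: dimension counts\<close>

lemma bw_internalD:
  assumes "bw_internal n B" "b \<in> B"
  shows "bw_spans n ((B - {b}) \<union> {x \<in> bw_ground n - B. b < x})"
proof -
  let ?A = "{b \<in> B. bw_spans n ((B - {b}) \<union> {x \<in> bw_ground n - B. b < x})}"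
  have "finite B" using assms finite_subset[of B "bw_ground n"]
    by (auto simp: bw_internal_def bw_basis_def bw_ground_def)
  moreover have "card ?A = card B"
    using assms by (simp add: bw_internal_def bw_basis_def bw_val_dual_def)
  \<comment> \<open>The dual valuation counts a subset of the finite set \<open>B\<close>; reaching
    the full size n forces the condition at every element.\<close>
  ultimately have "?A = B" by (intro card_subset_eq) auto
  then show ?thesis using assms(2) by blast
qed

lemma real_span_card_std_e:
  assumes "finite S" "finite I"
    and "carrier_vec n \<subseteq> real_span n (bw_vec n ` S \<union> std_e n ` I)"
  shows "n \<le> card S + card I"
proof -
  have c: "bw_vec n ` S \<union> std_e n ` I \<subseteq> carrier_vec n" by auto
  have "real_span n (bw_vec n ` S \<union> std_e n ` I) = carrier_vec n"
    using assms(3) real_span_closed[OF c] by blast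
  then have "n \<le> card (bw_vec n ` S \<union> std_e n ` I)"
    using assms(1,2) c by (intro real_span_card) simp_all
  also have "\<dots> \<le> card (bw_vec n ` S) + card (std_e n ` I)" by (rule card_Un_le)
  also have "\<dots> \<le> card S + card I" using assms by (intro add_mono card_image_le)
  finally show ?thesis .
qed

text \<open>The dimension count behind all exclusions below: vectors outside \<open>S\<close> are
  absorbed into a coordinate subspace of dimension at most \<open>card I\<close>. It is applied with
  an empty, a final and an initial range for \<open>I\<close>.\<close>

lemma bw_spans_card_std_e:
  assumes "bw_spans n T" "finite S" "finite I"
    and "\<And>t. t \<in> T \<Longrightarrow> t \<in> S \<or> bw_vec n t \<in> real_span n (std_e n ` I)"
  shows "n \<le> card S + card I"
proof (rule real_span_card_std_e[OF assms(2,3)])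
  let ?U = "bw_vec n ` S \<union> std_e n ` I"
  have c: "?U \<subseteq> carrier_vec n" by auto
  have "bw_vec n ` T \<subseteq> real_span n ?U"
  proof
    fix v assume "v \<in> bw_vec n ` T"
    then obtain t where t: "t \<in> T" "v = bw_vec n t" by blast
    from assms(4)[OF t(1)] show "v \<in> real_span n ?U"
    proof
      assume "t \<in> S" then show ?thesis using t c by (intro real_span_mem) auto
    next
      assume "bw_vec n t \<in> real_span n (std_e n ` I)"
      then show ?thesis using real_span_mono[of "std_e n ` I" ?U n] unfolding t(2) by blast
    qed
  qed
  then have "real_span n (bw_vec n ` T) \<subseteq> real_span n ?U" by (rule real_span_least[OF c])
  then show "carrier_vec n \<subseteq> real_span n ?U" using assms(1) by (simp add: bw_spans_def)
qed

text \<open>An odd index involves two consecutive unit vectors, so both subscripts have to lie in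
  \<open>I\<close>; \<open>k = 1\<close> is exempt because its second vector is e_0 = 0.\<close>

lemma bw_vec_in_span_std_e:
  assumes "t = 2 * k \<and> k \<in> I \<or> t = 2 * k - 1 \<and> k \<in> I \<and> k \<ge> 1 \<and> (k = 1 \<or> k - 1 \<in> I)"
  shows "bw_vec n t \<in> real_span n (std_e n ` I)"
proof -
  have c: "std_e n ` I \<subseteq> carrier_vec n" by auto
  have m: "std_e n i \<in> real_span n (std_e n ` I)" if "i \<in> I \<or> i = 0" for i
    using that real_span_mem[OF c] real_span_zero[of n] by (auto simp: std_e_def)
  from assms show ?thesis
  proof (elim disjE conjE)
    assume "t = 2 * k" "k \<in> I" then show ?thesis using m by (simp add: bw_vec_even)
  next
    assume "t = 2 * k - 1" "k \<in> I" "k \<ge> 1" "k = 1"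
    then show ?thesis using bw_vec_odd[of k n] real_span_diff[OF c m m, of k 0] by simp
  next
    assume "t = 2 * k - 1" "k \<in> I" "k \<ge> 1" "k - 1 \<in> I"
    then show ?thesis using bw_vec_odd[of k n] real_span_diff[OF c m m, of k "k - 1"] by simp
  qed
qed

text \<open>No index follows \<open>2 * n\<close>, so after its removal only n - 1 vectors would be
  left to span the space.\<close>

lemma bw_internal_not_last:
  assumes "bw_internal n B" "n \<ge> 1"
  shows "2 * n \<notin> B"
proof
  assume b: "2 * n \<in> B"
  have B: "B \<subseteq> bw_ground n" "card B = n"
    using assms by (auto simp: bw_internal_def bw_basis_def)
  then have fin: "finite B" using finite_subset[of B "bw_ground n"] by (auto simp: bw_ground_def)
  have "(B - {2 * n}) \<union> {x \<in> bw_ground n - B. 2 * n < x} = B - {2 * n}"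
    by (auto simp: bw_ground_def)
  then have "bw_spans n (B - {2 * n})" using bw_internalD[OF assms(1) b] by metis
  then have "n \<le> card (B - {2 * n}) + card ({} :: nat set)"
    using fin by (intro bw_spans_card_std_e) auto
  then show False using B fin b assms(2) by simp
qed

text \<open>Two dimension counts, from the internal condition at \<open>2 * i - 1\<close> and from
  spanning by \<open>B\<close>, bound the numbers of elements below and above the pair. Together
  they leave room for one further element, not two.\<close>

lemma bw_internal_not_both:
  assumes "bw_internal n B" "1 \<le> i" "i \<le> n" "2 * i - 1 \<in> B" "2 * i \<in> B"
  shows False
proof -
  have basis: "bw_basis n B" using assms by (simp add: bw_internal_def)
  then have B: "B \<subseteq> bw_ground n" "card B = n" by (auto simp: bw_basis_def)
  then have fin: "finite B" using finite_subset[of B "bw_ground n"] by (auto simp: bw_ground_def)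
  define L where "L = {b \<in> B. b < 2 * i - 1}"
  define R where "R = {b \<in> B. 2 * i < b}"
  \<comment> \<open>Besides \<open>L\<close>, only indices from \<open>2 * i\<close> on remain, and
    their vectors lie in the span of e_i, ..., e_n. This gives \<open>card L\<close> at least i -
    1.\<close>
  have "n \<le> card L + card {i..n}"
  proof (rule bw_spans_card_std_e[OF bw_internalD[OF assms(1,4)]])
    fix t assume "t \<in> (B - {2 * i - 1}) \<union> {x \<in> bw_ground n - B. 2 * i - 1 < x}"
    then have t: "t \<in> bw_ground n" "t \<in> L \<or> 2 * i - 1 < t" using B by (auto simp: L_def)
    show "t \<in> L \<or> bw_vec n t \<in> real_span n (std_e n ` {i..n})"
      using t(1)
    proof (cases rule: bw_ground_cases)
      case (1 k)
      have "t \<in> L \<or> i \<le> k" using t(2) 1 by auto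
      then show ?thesis using 1 bw_vec_in_span_std_e[of t k "{i..n}" n] by auto
    next
      case (2 k)
      \<comment> \<open>The removed index \<open>2 * i - 1\<close> is the only one that joins
        e_(i-1) to e_i; a later odd index starts at e_i or beyond.\<close>
      have "t \<in> L \<or> i \<le> k - 1" using t(2) 2 by auto
      then show ?thesis
      proof
        assume "i \<le> k - 1"
        then have "k \<in> {i..n}" "k - 1 \<in> {i..n}" using 2 by auto
        then show ?thesis using 2 bw_vec_in_span_std_e[of t k "{i..n}" n] by blast
      qed simp
    qed
  qed (auto simp: L_def fin)
  \<comment> \<open>Basis elements outside \<open>R\<close> are at most \<open>2 * i\<close> and
    involve only e_1, ..., e_i, so \<open>card R\<close> is at least n - i.\<close>
  moreover have "n \<le> card R + card {1..i}"
  proof (rule bw_spans_card_std_e[OF bw_basis_imp_spans[OF basis]])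
    fix t assume tB: "t \<in> B"
    then have "t \<in> bw_ground n" using B by blast
    then show "t \<in> R \<or> bw_vec n t \<in> real_span n (std_e n ` {1..i})"
    proof (cases rule: bw_ground_cases)
      case (1 k)
      then have "t \<in> R \<or> k \<in> {1..i}" using tB by (auto simp: R_def)
      then show ?thesis using 1 bw_vec_in_span_std_e[of t k "{1..i}" n] by blast
    next
      case (2 k)
      then have "t \<in> R \<or> k \<in> {1..i} \<and> (k = 1 \<or> k - 1 \<in> {1..i})"
        using tB by (auto simp: R_def)
      then show ?thesis using 2 bw_vec_in_span_std_e[of t k "{1..i}" n] by blast
    qed
  qed (auto simp: R_def fin)
  moreover have "card B = card L + card R + 2"
  proof -
    have "B = (L \<union> R) \<union> {2 * i - 1, 2 * i}" using assms by (auto simp: L_def R_def)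
    moreover have "card ((L \<union> R) \<union> {2 * i - 1, 2 * i}) = card (L \<union> R) + card {2 * i - 1, 2 * i}"
      using fin by (intro card_Un_disjoint) (auto simp: L_def R_def)
    moreover have "card (L \<union> R) = card L + card R"
      using fin by (intro card_Un_disjoint) (auto simp: L_def R_def)
    moreover have "card {2 * i - 1, 2 * i} = 2" using assms(2) by simp
    ultimately show ?thesis by simp
  qed
  ultimately show False using B(2) assms(2,3) by simp
qed

text \<open>An internal basis has at most one element in each pair, so it lies inside the
  transversal of its own even choices; both have n elements and therefore agree. Since
  \<open>2 * n\<close> is excluded, those choices stay below n.\<close>

lemma bw_internal_iff:
  assumes "n \<ge> 1"
  shows "bw_internal n B \<longleftrightarrow> (\<exists>E. E \<subseteq> {1..<n} \<and> B = bw_transversal n E)"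
proof
  assume int: "bw_internal n B"
  define E where "E = {i \<in> {1..n}. 2 * i \<in> B}"
  have B: "B \<subseteq> bw_ground n" "card B = n"
    using int by (auto simp: bw_internal_def bw_basis_def)
  have "B \<subseteq> bw_transversal n E"
  proof
    fix x assume x: "x \<in> B"
    then have "x \<in> bw_ground n" using B by blast
    then show "x \<in> bw_transversal n E"
    proof (cases rule: bw_ground_cases)
      case (1 i)
      then show ?thesis using x by (simp add: even_in_bw_transversal E_def)
    next
      case (2 i)
      then have "2 * i \<notin> B" using bw_internal_not_both[OF int] x by blast
      then show ?thesis using 2 odd_in_bw_transversal[of i n E] by (simp add: E_def)
    qed
  qed
  then have "B = bw_transversal n E"
    using B by (intro card_subset_eq) (auto simp: card_bw_transversal)
  moreover have "E \<subseteq> {1..<n}"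
    using bw_internal_not_last[OF int assms] by (auto simp: E_def le_less)
  ultimately show "\<exists>E. E \<subseteq> {1..<n} \<and> B = bw_transversal n E" by blast
qed (use bw_internal_transversal in blast)

section \<open>Counting internal bases by subsets of an (n - 1)-element set\<close>

lemma inj_on_bw_transversal: "inj_on (bw_transversal n) (Pow {1..n})"
proof (rule inj_onI)
  fix E F
  assume EF: "E \<in> Pow {1..n}" "F \<in> Pow {1..n}"
    and eq: "bw_transversal n E = bw_transversal n F"
  have "i \<in> E \<longleftrightarrow> i \<in> F" if "i \<in> {1..n}" for i
    using that even_in_bw_transversal[of i n E] even_in_bw_transversal[of i n F] eq by simp
  then show "E = F" using EF by blast
qed

theorem theorem3:
  fixes n j :: nat
  assumes "n \<ge> 1"
  shows "bw_hilbert_int n j = (if j < n then (n - 1) choose j else 0)"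
proof -
  have val: "bw_val n (bw_transversal n E) = card E" if "E \<subseteq> {1..<n}" for E
    using that by (intro bw_val_transversal) auto
  have "{B. bw_internal n B \<and> bw_val n B = j} =
      bw_transversal n ` {E. E \<subseteq> {1..<n} \<and> card E = j}" (is "?L = ?R")
  proof (intro equalityI subsetI)
    fix B assume "B \<in> ?L"
    then obtain E where E: "E \<subseteq> {1..<n}" "B = bw_transversal n E" "bw_val n B = j"
      using bw_internal_iff[OF assms] by blast
    then have "card E = j" using val[OF E(1)] by simp
    then show "B \<in> ?R" using E(1) unfolding E(2) by (intro imageI CollectI conjI)
  next
    fix B assume "B \<in> ?R"
    then obtain E where "E \<subseteq> {1..<n}" "B = bw_transversal n E" "card E = j" by blast
    then show "B \<in> ?L" using val[of E] bw_internal_transversal[of E n] by simp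
  qed
  moreover have "inj_on (bw_transversal n) {E. E \<subseteq> {1..<n} \<and> card E = j}"
    by (rule inj_on_subset[OF inj_on_bw_transversal]) (auto simp: subset_iff)
  ultimately have "bw_hilbert_int n j = card {E. E \<subseteq> {1..<n} \<and> card E = j}"
    by (simp add: bw_hilbert_int_def card_image)
  also have "\<dots> = (n - 1) choose j" using n_subsets[of "{1..<n}" j] by simp
  \<comment> \<open>For j at least n, the hypothesis n \<ge> 1 gives j > n - 1, so the binomial
    coefficient vanishes and agrees with the second case.\<close>
  finally show ?thesis using assms by (simp add: binomial_eq_0)
qed

end
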